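(* Let $n\ge 2$ and $N\ge n$ be integers. Then \[ \mathrm{ex}_<(N,\mathrm{AP}_n)=\binom{n-1}{2}+(n-2)(N-n+1). \]
   Context: An ordered graph is a graph whose vertex set is equipped with a total order; an $N$-vertex ordered graph is identified with a graph on $[N]=\{1,\dots,N\}$ ordered as the integers. An ordered graph $G$ contains an ordered graph $H$ if there is an injection $f:V(H)\to V(G)$ such that $f(i)<f(j)$ whenever $i<j$, and $f(i)f(j)\in E(G)$ whenever $ij\in E(H)$; otherwise $G$ avoids $H$. The ordered Turán number $\mathrm{ex}_<(N,H)$ is the maximum number of edges of an ordered graph on vertex set $[N]$ that avoids $H$. The alternating path $\mathrm{AP}_n$ is the ordered path on vertex set $[n]$ whose vertices, in the order they are traversed along the path, are $1, n, 2, n-1, 3, n-2, \dots$; that is, the $(2j-1)$-th vertex of the path is $j$ and the $(2j)$-th vertex is $n+1-j$. *)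

theory Defs
  imports Main "HOL-Library.Ramsey"
begin

text \<open>
  A graph is a pair of a vertex set and a set of two-element edges; the order on the vertices
  is that of the ambient linear order.
\<close>

type_synonym 'a ograph = "'a set \<times> 'a set set"

abbreviation verts :: "'a ograph \<Rightarrow> 'a set" where
  "verts G \<equiv> fst G"

abbreviation edges :: "'a ograph \<Rightarrow> 'a set set" where
  "edges G \<equiv> snd G"

definition ordered_graph :: "'a::linorder ograph \<Rightarrow> bool" where
  "ordered_graph G \<longleftrightarrow> finite (verts G) \<and> edges G \<subseteq> nsets (verts G) 2"

definition contains :: "'a::linorder ograph \<Rightarrow> 'b::linorder ograph \<Rightarrow> bool" where
  "contains G H \<longleftrightarrow>
     (\<exists>f. inj_on f (verts H) \<and> f ` verts H \<subseteq> verts G \<and>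
          (\<forall>i\<in>verts H. \<forall>j\<in>verts H. i < j \<longrightarrow> f i < f j) \<and>
          (\<forall>i\<in>verts H. \<forall>j\<in>verts H. {i, j} \<in> edges H \<longrightarrow> {f i, f j} \<in> edges G))"

definition avoids :: "'a::linorder ograph \<Rightarrow> 'b::linorder ograph \<Rightarrow> bool" where
  "avoids G H \<longleftrightarrow> \<not> contains G H"

text \<open>
  The maximum is over a finite set, which is nonempty as soon as \<open>H\<close> has an edge.
\<close>

definition ex_ord :: "nat \<Rightarrow> 'b::linorder ograph \<Rightarrow> nat" where
  "ex_ord N H =
     Max {card (edges G) | G :: nat ograph. ordered_graph G \<and> verts G = {1..N} \<and> avoids G H}"

text \<open>
  The \<open>k\<close>-th vertex traversed, for \<open>k = 1, \<dots>, n\<close>: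
  \<open>j\<close> if \<open>k = 2 j - 1\<close>, and \<open>n + 1 - j\<close> if \<open>k = 2 j\<close>.
\<close>

definition AP_vertex :: "nat \<Rightarrow> nat \<Rightarrow> nat" where
  "AP_vertex n k = (if odd k then (k + 1) div 2 else n + 1 - k div 2)"

definition AP :: "nat \<Rightarrow> nat ograph" where
  "AP n = ({1..n}, {{AP_vertex n k, AP_vertex n (k + 1)} | k. 1 \<le> k \<and> k < n})"

end

theory Submission
  imports Defs
begin

text \<open>
  The edges of length at most \<open>n - 2\<close> form an extremal graph, since \<open>AP n\<close> contains the edge
  \<open>{1, n}\<close>. For the upper bound, grow alternating paths from the inside out, moving the left and
  the right end of the outermost edge in turn. An edge that is outermost in a path with \<open>k\<close> edges
  fails to be outermost in one with \<open>k + 1\<close> edges only if it is the shortest such edge at its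
  right (respectively left) end; as such an edge has length at least \<open>k\<close>, there are at most
  \<open>N - k\<close> possible ends. So a graph with more than \<open>(N - 1) + \<dots> + (N - (n - 2))\<close> edges contains
  a path with \<open>n - 1\<close> edges.
\<close>

section \<open>Counting outermost edges of alternating paths\<close>

text \<open>
  The outermost edges of alternating paths with \<open>k + 1\<close> edges; the flag tells whether the last
  extension moved the left end.
\<close>

fun zigzag :: "('a::linorder \<times> 'a) set \<Rightarrow> bool \<Rightarrow> nat \<Rightarrow> ('a \<times> 'a) set" where
  "zigzag E d 0 = E"
| "zigzag E True (Suc k) = {(a, b) \<in> E. \<exists>a'>a. (a', b) \<in> zigzag E False k}"
| "zigzag E False (Suc k) = {(a, b) \<in> E. \<exists>b'<b. (a, b') \<in> zigzag E True k}"

lemma zigzag_subset: "zigzag E d k \<subseteq> E"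
  by (cases "(E, d, k)" rule: zigzag.cases) auto

text \<open>Every extension moves one end outwards by at least 1.\<close>

lemma zigzag_length:
  fixes E :: "(nat \<times> nat) set"
  assumes "\<And>a b. (a, b) \<in> E \<Longrightarrow> a < b" and "(a, b) \<in> zigzag E d k"
  shows "a + k < b"
  using assms(2)
proof (induction k arbitrary: a b d)
  case 0
  then show ?case using assms(1) by simp
next
  case (Suc k)
  then show ?case by (cases d) fastforce+
qed

lemma card_zigzag_step:
  fixes E :: "(nat \<times> nat) set"
  assumes E: "\<And>a b. (a, b) \<in> E \<Longrightarrow> 1 \<le> a \<and> a < b \<and> b \<le> N" and fin: "finite E"
  shows "card (zigzag E d k) \<le> card (zigzag E (\<not> d) (Suc k)) + (N - Suc k)"
proof -
  let ?D = "zigzag E d k - zigzag E (\<not> d) (Suc k)"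
  have len: "a + k < b" "1 \<le> a" "b \<le> N" "(a, b) \<in> E" if "(a, b) \<in> zigzag E d k" for a b
    using zigzag_length[of E a b d k] E zigzag_subset that by blast+
  have "card ?D \<le> N - Suc k"
  proof (cases d)
    case True
    \<comment> \<open>Of two edges with the same left end, the longer extends the shorter and so
      lies in \<open>zigzag E False (Suc k)\<close>, outside \<open>?D\<close>.\<close>
    have "inj_on fst ?D"
    proof (rule inj_onI)
      fix p q assume "p \<in> ?D" "q \<in> ?D" "fst p = fst q"
      then show "p = q"
        using True len(4)
        by (cases p; cases q; cases "snd p" "snd q" rule: linorder_cases) auto
    qed
    moreover have "fst ` ?D \<subseteq> {1..N - Suc k}"
      using len by fastforce
    ultimately show ?thesis
      using card_inj_on_le[of fst ?D "{1..N - Suc k}"] by simp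
  next
    case False
    have "inj_on snd ?D"
    proof (rule inj_onI)
      fix p q assume "p \<in> ?D" "q \<in> ?D" "snd p = snd q"
      then show "p = q"
        using False len(4)
        by (cases p; cases q; cases "fst p" "fst q" rule: linorder_cases) auto
    qed
    \<comment> \<open>From \<open>a + k < b\<close> and \<open>a \<ge> 1\<close>: the mirror image
      of the range of left ends, again of size \<open>N - Suc k\<close>.\<close>
    moreover have "snd ` ?D \<subseteq> {Suc (Suc k)..N}"
      using len by fastforce
    ultimately show ?thesis
      using card_inj_on_le[of snd ?D "{Suc (Suc k)..N}"] by simp
  qed
  moreover have "card (zigzag E d k) \<le> card (zigzag E (\<not> d) (Suc k) \<union> ?D)"
    by (rule card_mono) (auto intro: finite_subset[OF zigzag_subset fin])
  ultimately show ?thesis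
    using card_Un_le[of "zigzag E (\<not> d) (Suc k)" ?D] by linarith
qed

lemma card_le_card_zigzag:
  fixes E :: "(nat \<times> nat) set"
  assumes "\<And>a b. (a, b) \<in> E \<Longrightarrow> 1 \<le> a \<and> a < b \<and> b \<le> N" and "finite E"
  shows "card E \<le> card (zigzag E d k) + (\<Sum>i=1..k. N - i)"
\<comment> \<open>\<open>d\<close> is generalised because each step flips the flag.\<close>
proof (induction k arbitrary: d)
  case 0
  then show ?case by simp
next
  case (Suc k)
  show ?case
    using Suc[of "\<not> d"] card_zigzag_step[OF assms, of "\<not> d" k] by simp
qed

section \<open>From outermost edges to embedded paths\<close>

text \<open>
  The edges of \<open>AP n\<close> are the pairs with sum \<open>n + 1\<close> or \<open>n + 2\<close>, those of its mirror image the
  pairs with sum \<open>n\<close> or \<open>n + 1\<close>; here \<open>n = k + 2\<close>.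
\<close>

lemma zigzag_embedding:
  assumes "\<And>a b. (a, b) \<in> E \<Longrightarrow> a < b" and "(a, b) \<in> zigzag E d k"
  shows "\<exists>f :: nat \<Rightarrow> 'a::linorder. f 1 = a \<and> f (k + 2) = b \<and> strict_mono_on {1..k + 2} f \<and>
    (\<forall>i j. 1 \<le> i \<longrightarrow> i < j \<longrightarrow> j \<le> k + 2 \<longrightarrow>
       i + j \<in> (if d then {k + 3, k + 4} else {k + 2, k + 3}) \<longrightarrow> (f i, f j) \<in> E)"
  using assms(2)
proof (induction k arbitrary: a b d)
  case 0
  have edge: "i = 1 \<and> j = 2" if "1 \<le> i" "i < j" "j \<le> 0 + 2" for i j :: nat
    using that by linarith
  show ?case
    using 0 assms(1)[of a b]
    by (intro exI[of _ "\<lambda>i. if i = 1 then a else b"]) (fastforce simp: strict_mono_on_def dest: edge)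
next
  case (Suc k)
  show ?case
  proof (cases d)
    case True
    then obtain a' where a': "a < a'" "(a', b) \<in> zigzag E False k" and ab: "(a, b) \<in> E"
      using Suc.prems by auto
    from Suc.IH[OF a'(2)] obtain f where f: "f 1 = a'" "f (k + 2) = b"
      and mono: "strict_mono_on {1..k + 2} f"
      and edge: "\<And>i j. 1 \<le> i \<Longrightarrow> i < j \<Longrightarrow> j \<le> k + 2 \<Longrightarrow> i + j \<in> {k + 2, k + 3} \<Longrightarrow> (f i, f j) \<in> E"
      by auto
    have ge: "a < f i" if "1 \<le> i" "i \<le> k + 2" for i
      using a'(1) f(1) that strict_mono_onD[OF mono, of 1 i]
      by (cases "i = 1") (auto intro: less_trans)
    \<comment> \<open>Prepending \<open>a\<close> shifts the old indices by 1 and their sums by 2,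
      which turns the mirror image's sums into those of the path; the new vertex 1 is joined only to
      \<open>k + 3\<close>.\<close>
    let ?g = "\<lambda>i. if i = 1 then a else f (i - 1)"
    have "strict_mono_on {1..Suc k + 2} ?g"
      using ge by (auto simp: strict_mono_on_def intro!: strict_mono_onD[OF mono])
    moreover have "(?g i, ?g j) \<in> E"
      if "1 \<le> i" "i < j" "j \<le> Suc k + 2" "i + j \<in> {Suc k + 3, Suc k + 4}" for i j
    proof (cases "i = 1")
      case True
      then have "j = k + 3" using that by auto
      then show ?thesis using True ab f(2) by (simp add: numeral_eq_Suc)
    next
      case False
      then have "(f (i - 1), f (j - 1)) \<in> E" using that by (intro edge) auto
      then show ?thesis using False that by auto
    qed
    ultimately show ?thesis
      using True f by (intro exI[of _ ?g]) (auto simp: numeral_eq_Suc)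
  next
    case False
    then obtain b' where b': "b' < b" "(a, b') \<in> zigzag E True k" and ab: "(a, b) \<in> E"
      using Suc.prems by auto
    from Suc.IH[OF b'(2)] obtain f where f: "f 1 = a" "f (k + 2) = b'"
      and mono: "strict_mono_on {1..k + 2} f"
      and edge: "\<And>i j. 1 \<le> i \<Longrightarrow> i < j \<Longrightarrow> j \<le> k + 2 \<Longrightarrow> i + j \<in> {k + 3, k + 4} \<Longrightarrow> (f i, f j) \<in> E"
      by auto
    have le: "f i < b" if "1 \<le> i" "i \<le> k + 2" for i
      using b'(1) f(2) that strict_mono_onD[OF mono, of i "k + 2"]
      by (cases "i = k + 2") (auto intro: less_trans)
    \<comment> \<open>Appending \<open>b\<close> keeps the old indices and sums; the new vertex
      \<open>k + 3\<close> is joined only to 1.\<close>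
    let ?g = "\<lambda>i. if i = k + 3 then b else f i"
    have "strict_mono_on {1..Suc k + 2} ?g"
      using le by (auto simp: strict_mono_on_def intro!: strict_mono_onD[OF mono])
    moreover have "(?g i, ?g j) \<in> E"
      if "1 \<le> i" "i < j" "j \<le> Suc k + 2" "i + j \<in> {Suc k + 2, Suc k + 3}" for i j
    proof (cases "j = k + 3")
      case True
      then have "i = 1" using that by auto
      then show ?thesis using True ab f(1) by simp
    next
      case False
      then have "(f i, f j) \<in> E" using that by (intro edge) auto
      then show ?thesis using False that by auto
    qed
    ultimately show ?thesis
      using False f by (intro exI[of _ ?g]) auto
  qed
qed

section \<open>The upper bound\<close>

lemma verts_AP: "verts (AP n) = {1..n}"
  by (simp add: AP_def)

text \<open>Steps from even \<open>k\<close> have sum \<open>n + 2\<close>, those from odd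
  \<open>k\<close> sum \<open>n + 1\<close>; the two vertices could coincide only at
  \<open>k = n\<close>. So the pairs supplied by \<open>zigzag_embedding\<close> cover all edges of
  \<open>AP n\<close>.\<close>

lemma AP_edge_sum:
  assumes "{i, j} \<in> edges (AP n)"
  shows "i + j \<in> {n + 1, n + 2}" and "i \<noteq> j"
proof -
  obtain k where k: "{i, j} = {AP_vertex n k, AP_vertex n (k + 1)}" "1 \<le> k" "k < n"
    using assms by (auto simp: AP_def)
  have "AP_vertex n k + AP_vertex n (k + 1) \<in> {n + 1, n + 2} \<and>
      AP_vertex n k \<noteq> AP_vertex n (k + 1)"
  proof (cases "even k")
    case True
    then obtain m where "k = 2 * m" by blast
    then show ?thesis using k by (auto simp: AP_vertex_def)
  next
    case False
    then obtain m where "k = 2 * m + 1" by (auto elim: oddE)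
    then show ?thesis using k by (auto simp: AP_vertex_def)
  qed
  then show "i + j \<in> {n + 1, n + 2}" "i \<noteq> j"
    using k(1) by (auto simp: doubleton_eq_iff add.commute)
qed

definition edge_pairs :: "'a::linorder ograph \<Rightarrow> ('a \<times> 'a) set" where
  "edge_pairs G = {(a, b). a < b \<and> {a, b} \<in> edges G}"

lemma card_edge_pairs:
  assumes "ordered_graph G"
  shows "card (edge_pairs G) = card (edges G)"
proof -
  have "inj_on (\<lambda>(a, b). {a, b}) (edge_pairs G)"
    by (auto simp: inj_on_def edge_pairs_def doubleton_eq_iff)
  moreover have "(\<lambda>(a, b). {a, b}) ` edge_pairs G = edges G"
  proof
    show "edges G \<subseteq> (\<lambda>(a, b). {a, b}) ` edge_pairs G"
    proof
      fix e assume e: "e \<in> edges G"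
      then obtain x y where "e = {x, y}" "x < y"
        using assms by (auto simp: ordered_graph_def nsets_def card_2_iff
            dest!: subsetD) (metis insert_commute linorder_neqE)
      then show "e \<in> (\<lambda>(a, b). {a, b}) ` edge_pairs G"
        using e by (force simp: edge_pairs_def)
    qed
  qed (auto simp: edge_pairs_def)
  ultimately show ?thesis
    using card_image by fastforce
qed

lemma card_edges_avoids_AP:
  assumes G: "ordered_graph G" "verts G = {1..N}" "avoids G (AP n)" and n: "n \<ge> 2"
  shows "card (edges G) \<le> (\<Sum>i=1..n - 2. N - i)"
proof -
  let ?E = "edge_pairs G"
  have E: "1 \<le> a \<and> a < b \<and> b \<le> N" if "(a, b) \<in> ?E" for a b
  proof -
    have "a < b" "{a, b} \<subseteq> verts G"
      using that G(1) by (auto simp: edge_pairs_def ordered_graph_def nsets_def)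
    then show ?thesis using G(2) by simp
  qed
  have "?E \<subseteq> {1..N} \<times> {1..N}"
    using E by fastforce
  then have fin: "finite ?E"
    by (rule finite_subset) simp
  \<comment> \<open>Index \<open>n - 2\<close> means \<open>n - 1\<close> edges; the flag
    \<open>True\<close> yields \<open>AP n\<close> rather than its mirror image.\<close>
  have "zigzag ?E True (n - 2) = {}"
  proof (rule ccontr)
    assume "zigzag ?E True (n - 2) \<noteq> {}"
    then obtain a b where "(a, b) \<in> zigzag ?E True (n - 2)" by auto
    moreover have "n - 2 + 2 = n" "n - 2 + 3 = n + 1" "n - 2 + 4 = n + 2"
      using n by simp_all
    ultimately obtain f where f: "f 1 = a" "f n = b"
      and mono: "strict_mono_on {1..n} f"
      and edge: "\<And>i j. 1 \<le> i \<Longrightarrow> i < j \<Longrightarrow> j \<le> n \<Longrightarrow> i + j \<in> {n + 1, n + 2} \<Longrightarrow> (f i, f j) \<in> ?E"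
      using zigzag_embedding[of ?E a b True "n - 2"] E by (metis (full_types))
    \<comment> \<open>The pair \<open>(1, n)\<close> has sum \<open>n + 1\<close>, so
      \<open>(a, b)\<close> is an edge; its ends bound all values of \<open>f\<close>.\<close>
    have ab: "1 \<le> a" "b \<le> N"
      using E[of a b] edge[of 1 n] f n by auto
    have "f ` {1..n} \<subseteq> {1..N}"
    proof clarify
      fix i assume i: "i \<in> {1..n}"
      then have "f 1 \<le> f i" "f i \<le> f n"
        using strict_mono_on_leD[OF mono] by auto
      then show "f i \<in> {1..N}" using ab f by simp
    qed
    moreover have "{f i, f j} \<in> edges G"
      if "i \<in> {1..n}" "j \<in> {1..n}" "{i, j} \<in> edges (AP n)" for i j
    proof (cases "i < j")
      case True
      then show ?thesis
        using edge[of i j] AP_edge_sum[OF that(3)] that by (auto simp: edge_pairs_def)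
    next
      case False
      then show ?thesis
        using edge[of j i] AP_edge_sum[OF that(3)] that
        by (auto simp: edge_pairs_def insert_commute add.commute)
    qed
    moreover have "inj_on f {1..n}"
      using mono by (rule strict_mono_on_imp_inj_on)
    moreover have "f i < f j" if "i \<in> {1..n}" "j \<in> {1..n}" "i < j" for i j
      using strict_mono_onD[OF mono] that by blast
    ultimately have "contains G (AP n)"
      unfolding contains_def verts_AP using G(2) by (intro exI[of _ f]) auto
    then show False using G(3) by (simp add: avoids_def)
  qed
  then show ?thesis
    using card_le_card_zigzag[of ?E N True "n - 2"] E fin card_edge_pairs[OF G(1)] by simp
qed

section \<open>The extremal graph\<close>

text \<open>Indexing edges by length and left end makes their number literally the upper bound; for
  \<open>d \<ge> N\<close> there are no left ends.\<close>

definition short_edge_graph :: "nat \<Rightarrow> nat \<Rightarrow> nat ograph" where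
  "short_edge_graph N m = ({1..N}, (\<lambda>(d, i). {i, i + d}) ` (SIGMA d:{1..m}. {1..N - d}))"

lemma ordered_short_edge_graph: "ordered_graph (short_edge_graph N m)"
  by (auto simp: ordered_graph_def short_edge_graph_def nsets_def)

lemma card_edges_short_edge_graph: "card (edges (short_edge_graph N m)) = (\<Sum>d=1..m. N - d)"
proof -
  have "inj_on (\<lambda>(d, i). {i, i + d}) (SIGMA d:{1..m}. {1..N - d})"
    by (auto simp: inj_on_def doubleton_eq_iff)
  then show ?thesis
    by (simp add: short_edge_graph_def card_image)
qed

lemma short_edge_graph_avoids_AP:
  assumes "n \<ge> 2"
  shows "avoids (short_edge_graph N (n - 2)) (AP n)"
  unfolding avoids_def
proof
  assume "contains (short_edge_graph N (n - 2)) (AP n)"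
  then obtain f :: "nat \<Rightarrow> nat" where 
    mono: "\<forall>i\<in>{1..n}. \<forall>j\<in>{1..n}. i < j \<longrightarrow> f i < f j" and
    edge: "\<forall>i\<in>{1..n}. \<forall>j\<in>{1..n}. {i, j} \<in> edges (AP n) \<longrightarrow>
      {f i, f j} \<in> edges (short_edge_graph N (n - 2))"
    unfolding contains_def verts_AP by (elim exE conjE) (rule that)
  \<comment> \<open>This is the first edge traversed, \<open>k = 1\<close>.\<close>
  have "{1, n} \<in> edges (AP n)"
    using assms by (auto simp: AP_def AP_vertex_def intro!: exI[of _ 1])
  then have "{f 1, f n} \<in> edges (short_edge_graph N (n - 2))"
    using edge assms by simp
  then have "f n \<le> f 1 + (n - 2)"
    by (auto simp: short_edge_graph_def doubleton_eq_iff)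
  \<comment> \<open>A strictly increasing integer map stretches \<open>{1, n}\<close> to length at
    least \<open>n - 1\<close>, more than any edge has.\<close>
  moreover have "f 1 + k \<le> f (1 + k)" if "k < n" for k
    using that
  proof (induction k)
    case (Suc k)
    then show ?case using mono[rule_format, of "1 + k" "1 + Suc k"] by simp
  qed simp
  from this[of "n - 1"] have "f 1 + (n - 1) \<le> f n"
    using assms by simp
  ultimately show False using assms by linarith
qed

section \<open>Closed form and conclusion\<close>

text \<open>Split \<open>N - d\<close> as \<open>(N - Suc m) + (Suc m - d)\<close>; the second
  summands run through \<open>m, ..., 1\<close>.\<close>

lemma sum_diff_eq_choose:
  fixes N m :: nat
  assumes "m < N"
  shows "(\<Sum>d=1..m. N - d) = (Suc m choose 2) + m * (N - Suc m)"
  using assms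
proof (induction m)
  case (Suc m)
  then obtain r where "N = Suc (Suc m) + r"
    using less_imp_add_positive by (metis Suc_leI le_Suc_ex)
  then show ?case
    using Suc by (simp add: numeral_2_eq_2)
qed simp

theorem theorem1p2:
  fixes n N :: nat
  assumes "n \<ge> 2" and "N \<ge> n"
  shows "ex_ord N (AP n) = ((n - 1) choose 2) + (n - 2) * (N - n + 1)"
proof -
  let ?S = "{card (edges G) | G :: nat ograph. ordered_graph G \<and> verts G = {1..N} \<and> avoids G (AP n)}"
  let ?s = "\<Sum>d=1..n - 2. N - d"
  \<comment> \<open>The bound also gives the finiteness on which \<open>Max\<close> relies.\<close>
  have le: "x \<le> ?s" if "x \<in> ?S" for x
    using that card_edges_avoids_AP assms(1) by blast
  have "finite ?S"
    by (rule finite_subset[of _ "{..?s}"]) (use le in auto)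
  moreover have "?s \<in> ?S"
    using ordered_short_edge_graph card_edges_short_edge_graph short_edge_graph_avoids_AP[OF assms(1)]
    by (intro CollectI exI[of _ "short_edge_graph N (n - 2)"]) (simp add: short_edge_graph_def)
  ultimately have "ex_ord N (AP n) = ?s"
    unfolding ex_ord_def using le by (intro Max_eqI) auto
  also have "\<dots> = (Suc (n - 2) choose 2) + (n - 2) * (N - Suc (n - 2))"
    using assms by (intro sum_diff_eq_choose) linarith
  also have "Suc (n - 2) = n - 1" using assms by simp
  also have "N - (n - 1) = N - n + 1" using assms by simp
  finally show ?thesis .
qed

end
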